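(* Let $q\in\mathbb{C}$ with $0<|q|<1$, let $x\in\mathbb{C}$, and let $n,k\in\mathbb{N}$ with $k\le n$. Let $b_{n,k}(q;x)=\begin{bmatrix} n \\ k \end{bmatrix}_q x^{k}(1-x)_q^{n-k}$ be the Phillips $q$-Bernstein basis polynomial. Then \[ b_{n,k}(q;x)=x^{k}\sum_{m=0}^{n}\begin{bmatrix} n \\ m \end{bmatrix}_q S_{2,q}(m,k)\,\mathfrak{B}_{n-m,q}^{(k)}(1,-x). \]
   Context: For $q\in\mathbb{C}$, $0<|q|<1$: $[n]_q=\frac{1-q^n}{1-q}$, $[0]_q!=1$, $[n]_q!=[1]_q[2]_q\cdots[n]_q$, and $\begin{bmatrix} n \\ k \end{bmatrix}_q=\frac{[n]_q!}{[k]_q![n-k]_q!}$ for $0\le k\le n$. For $n\ge 0$, $(1-x)_q^n=\prod_{j=0}^{n-1}(1-q^jx)=\sum_{k=0}^n\begin{bmatrix} n \\ k \end{bmatrix}_q q^{k(k-1)/2}(-x)^k$. Set $e_q(z)=\sum_{n\ge0}\frac{z^n}{[n]_q!}$ and $E_q(z)=\sum_{n\ge0}\frac{q^{n(n-1)/2}z^n}{[n]_q!}$. The $q$-Bernoulli polynomials of order $\alpha\in\mathbb{C}$ are defined by the power series expansion in $t$ around $0$ \[ \left(\frac{t}{e_q(t)-1}\right)^{\alpha}e_q(tx)E_q(ty)=\sum_{n=0}^\infty\mathfrak{B}_{n,q}^{(\alpha)}(x,y)\frac{t^n}{[n]_q!}, \] where the $\alpha$-th power of a power series with constant term $1$ is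 the one with constant term $1$ (here $\alpha=k$). The $q$-Stirling numbers of the second kind $S_{2,q}(m,k)$, $k\in\mathbb{N}$, are defined by \[ \frac{(e_q(t)-1)^k}{[k]_q!}=\sum_{m=0}^\infty S_{2,q}(m,k)\frac{t^m}{[m]_q!}. \] *)

theory Defs
  imports Complex_Main "HOL-Computational_Algebra.Formal_Power_Series"
begin

unbundle fps_syntax

text \<open>
  All generating functions in \<open>t\<close> are formal power series over the complex numbers, with
  \<open>t\<close> rendered as \<^const>\<open>fps_X\<close>.
\<close>

definition qnat :: "complex \<Rightarrow> nat \<Rightarrow> complex" where
  "qnat q n = (1 - q ^ n) / (1 - q)"

definition qfact :: "complex \<Rightarrow> nat \<Rightarrow> complex" where
  "qfact q n = (\<Prod>i=1..n. qnat q i)"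

text \<open>Only meaningful for \<open>k \<le> n\<close>, as the subtraction on naturals truncates.\<close>
definition qbinom :: "complex \<Rightarrow> nat \<Rightarrow> nat \<Rightarrow> complex" where
  "qbinom q n k = qfact q n / (qfact q k * qfact q (n - k))"

text \<open>The product written \<open>(1 - x)\<^sub>q\<^sup>n\<close>.\<close>
definition qone_minus_pow :: "complex \<Rightarrow> complex \<Rightarrow> nat \<Rightarrow> complex" where
  "qone_minus_pow q x n = (\<Prod>j<n. 1 - q ^ j * x)"

text \<open>The two \<open>q\<close>-exponential series \<open>e\<^sub>q\<close> and \<open>E\<^sub>q\<close>.\<close>
definition qexp_small :: "complex \<Rightarrow> complex fps" where
  "qexp_small q = Abs_fps (\<lambda>n. 1 / qfact q n)"

definition qexp_big :: "complex \<Rightarrow> complex fps" where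
  "qexp_big q = Abs_fps (\<lambda>n. q ^ (n * (n - 1) div 2) / qfact q n)"

text \<open>
  For a series \<open>f\<close> with constant term \<open>1\<close>: the binomial series
  \<open>\<Sum>j. (\<alpha> gchoose j) * (f - 1) ^ j\<close>, that is, the \<open>\<alpha>\<close>-th power of \<open>f\<close>
  with constant term \<open>1\<close>.
\<close>
definition fps_cpow :: "complex fps \<Rightarrow> complex \<Rightarrow> complex fps" where
  "fps_cpow f \<alpha> = fps_binomial \<alpha> oo (f - 1)"

lemma fps_cpow_nth_0: "fps_cpow f \<alpha> $ 0 = 1"
  by (simp add: fps_cpow_def)

lemma fps_cpow_of_nat:
  assumes "f $ 0 = 1"
  shows "fps_cpow f (of_nat k) = f ^ k"
  using assms
  by (simp add: fps_cpow_def fps_binomial_of_nat fps_compose_power[symmetric] fps_compose_add_distrib)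

text \<open>The coefficient of \<open>t\<^sup>n / [n]\<^sub>q!\<close> in \<open>(t / (e\<^sub>q(t) - 1))\<^sup>\<alpha> e\<^sub>q(t x) E\<^sub>q(t y)\<close>.\<close>
definition qbernoulli_poly ::
  "complex \<Rightarrow> complex \<Rightarrow> nat \<Rightarrow> complex \<Rightarrow> complex \<Rightarrow> complex" where
  "qbernoulli_poly q \<alpha> n x y =
     qfact q n *
     (fps_cpow (fps_X / (qexp_small q - 1)) \<alpha>
        * (qexp_small q oo (fps_const x * fps_X))
        * (qexp_big q oo (fps_const y * fps_X))) $ n"

text \<open>The coefficient of \<open>t\<^sup>m / [m]\<^sub>q!\<close> in \<open>(e\<^sub>q(t) - 1)\<^sup>k / [k]\<^sub>q!\<close>.\<close>
definition qstirling2 :: "complex \<Rightarrow> nat \<Rightarrow> nat \<Rightarrow> complex" where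
  "qstirling2 q m k =
     qfact q m * (fps_const (1 / qfact q k) * (qexp_small q - 1) ^ k) $ m"

definition qbernstein :: "complex \<Rightarrow> nat \<Rightarrow> nat \<Rightarrow> complex \<Rightarrow> complex" where
  "qbernstein q n k x = qbinom q n k * x ^ k * qone_minus_pow q x (n - k)"

lemma qfact_nonzero:
  assumes "norm q < 1"
  shows "qfact q n \<noteq> 0"
proof -
  have "q ^ i \<noteq> 1" if "i \<ge> 1" for i
  proof
    assume "q ^ i = 1"
    moreover have "norm q ^ i < 1"
      using that assms by (simp add: power_less_one_iff)
    ultimately show False
      by (metis norm_one norm_power less_irrefl)
  qed
  moreover have "q \<noteq> 1"
    using assms by auto
  ultimately show ?thesis
    by (auto simp: qfact_def qnat_def)
qed

text \<open>The series raised to the power \<open>\<alpha>\<close> does have constant term \<open>1\<close>.\<close>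
lemma qbernoulli_base_nth_0:
  assumes "norm q < 1"
  shows "(fps_X / (qexp_small q - 1)) $ 0 = 1"
proof -
  have coeffs [simp]: "qexp_small q $ 0 = 1" "qexp_small q $ Suc 0 = 1"
    using assms by (auto simp: qexp_small_def qfact_def qnat_def)
  have nz: "qexp_small q - 1 \<noteq> 0"
    using coeffs(2) by (auto simp del: coeffs)
  have sd: "subdegree (qexp_small q - 1) = 1"
    by (rule subdegreeI) auto
  have "(qexp_small q - 1) dvd (fps_X :: complex fps)"
    using nz sd by (simp add: fps_dvd_iff)
  then have "fps_X = (fps_X / (qexp_small q - 1)) * (qexp_small q - 1)"
    by simp
  then have "(fps_X :: complex fps) $ 1 = ((fps_X / (qexp_small q - 1)) * (qexp_small q - 1)) $ 1"
    by simp
  then show ?thesis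
    by (simp add: fps_mult_nth_1)
qed

lemma qbernoulli_poly_genfun:
  assumes "norm q < 1"
  shows "fps_cpow (fps_X / (qexp_small q - 1)) \<alpha>
           * (qexp_small q oo (fps_const x * fps_X))
           * (qexp_big q oo (fps_const y * fps_X))
         = Abs_fps (\<lambda>n. qbernoulli_poly q \<alpha> n x y / qfact q n)"
  by (simp add: fps_eq_iff qbernoulli_poly_def qfact_nonzero[OF assms])

lemma qstirling2_genfun:
  assumes "norm q < 1"
  shows "fps_const (1 / qfact q k) * (qexp_small q - 1) ^ k
         = Abs_fps (\<lambda>m. qstirling2 q m k / qfact q m)"
  by (simp add: fps_eq_iff qstirling2_def qfact_nonzero[OF assms])

end

theory Submission
  imports Defs
begin

text \<open>
  The sum over \<open>m\<close> is a Cauchy product. Since the \<open>q\<close>-binomial coefficient contributes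
  \<open>[n]\<^sub>q! / ([m]\<^sub>q! [n - m]\<^sub>q!)\<close>, the sum is \<open>[n]\<^sub>q!\<close> times the coefficient
  of \<open>t\<^sup>n\<close> in the product of the generating functions of the \<open>q\<close>-Stirling numbers and of the
  \<open>q\<close>-Bernoulli polynomials of order \<open>k\<close>. In that product the factors \<open>(e\<^sub>q(t) - 1)\<^sup>k\<close> and
  \<open>(t / (e\<^sub>q(t) - 1))\<^sup>k\<close> collapse to \<open>t\<^sup>k\<close>, which leaves
  \<open>t\<^sup>k e\<^sub>q(t) E\<^sub>q(- x t) / [k]\<^sub>q!\<close>
  (lemmas \<open>sum_qbinom_mult\<close> and \<open>qstirling2_mult_qbernoulli_genfun\<close>).

  What remains is the generating function
  \<open>e\<^sub>q(t) E\<^sub>q(- x t) = \<Sum>n. (1 - x)\<^sub>q\<^sup>n t\<^sup>n / [n]\<^sub>q!\<close> of lemma \<open>qexp_product_nth\<close>, a form of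
  Gauss's \<open>q\<close>-binomial formula. It comes from the behaviour of the two exponentials under the
  dilation \<open>t \<mapsto> q t\<close>, namely
  \<open>e\<^sub>q(q t) = (1 - (1 - q) t) e\<^sub>q(t)\<close> and \<open>E\<^sub>q(t) = (1 + (1 - q) t) E\<^sub>q(q t)\<close>. Together they say
  that \<open>F(t) = e\<^sub>q(t) E\<^sub>q(- x t)\<close> satisfies
  \<open>(1 - (1 - q) t) F(t) = (1 - (1 - q) x t) F(q t)\<close>, and comparing coefficients gives the
  recurrence of the products \<open>(1 - x)\<^sub>q\<^sup>n\<close>.
\<close>

lemma qfact_0 [simp]: "qfact q 0 = 1"
  by (simp add: qfact_def)

lemma qfact_Suc: "qfact q (Suc n) = qnat q (Suc n) * qfact q n"
  by (simp add: qfact_def mult.commute)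

lemma one_minus_mult_qnat:
  assumes "q \<noteq> 1"
  shows "(1 - q) * qnat q n = 1 - q ^ n"
  using assms by (simp add: qnat_def)

lemma inverse_qfact_Suc:
  assumes "norm q < 1"
  shows "(1 - q ^ Suc n) / qfact q (Suc n) = (1 - q) / qfact q n"
proof -
  have "q \<noteq> 1"
    using assms by auto
  then have "1 - q ^ Suc n = (1 - q) * qnat q (Suc n)"
    by (rule one_minus_mult_qnat[symmetric])
  moreover have "qnat q (Suc n) \<noteq> 0"
    using qfact_nonzero[OF assms, of "Suc n"] by (simp add: qfact_Suc)
  ultimately show ?thesis
    by (simp add: qfact_Suc)
qed

text \<open>
  This says that \<open>e\<^sub>q\<close> is its own \<open>q\<close>-derivative:
  \<open>(e\<^sub>q(t) - e\<^sub>q(q t)) / ((1 - q) t) = e\<^sub>q(t)\<close>. On coefficients it is the preceding lemma.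
\<close>
lemma qexp_small_dilate:
  assumes "norm q < 1"
  shows "qexp_small q oo (fps_const q * fps_X) = (1 - fps_const (1 - q) * fps_X) * qexp_small q"
proof (rule fps_ext)
  fix n
  show "(qexp_small q oo (fps_const q * fps_X)) $ n
          = ((1 - fps_const (1 - q) * fps_X) * qexp_small q) $ n"
  proof (cases n)
    case 0
    then show ?thesis
      by (simp add: qexp_small_def)
  next
    case (Suc m)
    have "q ^ Suc m / qfact q (Suc m) = 1 / qfact q (Suc m) - (1 - q) / qfact q m"
      using inverse_qfact_Suc[OF assms, of m] by (simp add: diff_divide_distrib algebra_simps)
    then show ?thesis
      unfolding Suc fps_compose_linear by (simp add: qexp_small_def left_diff_distrib mult.assoc)
  qed
qed

lemma triangle_Suc: "Suc m * (Suc m - 1) div 2 = m * (m - 1) div 2 + (m::nat)"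
  by (cases m) simp_all

text \<open>
  The \<open>q\<close>-derivative of \<open>E\<^sub>q(t)\<close> is \<open>E\<^sub>q(q t)\<close>, the factor \<open>q\<^sup>n\<close> gained by the triangular
  exponents at each step being absorbed into the argument. The scaling by \<open>c\<close> is there to apply
  the equation to \<open>E\<^sub>q(- x t)\<close>.
\<close>
lemma qexp_big_dilate:
  assumes "norm q < 1"
  shows "qexp_big q oo (fps_const c * fps_X)
         = (1 + fps_const ((1 - q) * c) * fps_X) * (qexp_big q oo (fps_const (c * q) * fps_X))"
proof (rule fps_ext)
  fix n
  show "(qexp_big q oo (fps_const c * fps_X)) $ n
          = ((1 + fps_const ((1 - q) * c) * fps_X)
              * (qexp_big q oo (fps_const (c * q) * fps_X))) $ n"
  proof (cases n)
    case 0
    then show ?thesis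
      by (simp add: qexp_big_def)
  next
    case (Suc m)
    define Q where "Q = q ^ (m * (m - 1) div 2)"
    have nth: "qexp_big q $ Suc m = Q * q ^ m / qfact q (Suc m)" "qexp_big q $ m = Q / qfact q m"
      by (simp_all only: qexp_big_def fps_nth_Abs_fps triangle_Suc power_add Q_def)
    have "c ^ Suc m * (Q * q ^ m / qfact q (Suc m))
            - (c * q) ^ Suc m * (Q * q ^ m / qfact q (Suc m))
          = c ^ Suc m * Q * q ^ m * ((1 - q ^ Suc m) / qfact q (Suc m))"
      by (simp add: power_mult_distrib diff_divide_distrib algebra_simps)
    also have "\<dots> = (1 - q) * c * ((c * q) ^ m * (Q / qfact q m))"
      by (simp add: inverse_qfact_Suc[OF assms] power_mult_distrib del: power_Suc)
         (simp add: mult_ac)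
    finally have "c ^ Suc m * (Q * q ^ m / qfact q (Suc m))
          = (c * q) ^ Suc m * (Q * q ^ m / qfact q (Suc m))
            + (1 - q) * c * ((c * q) ^ m * (Q / qfact q m))"
      by (simp only: diff_eq_eq add.commute)
    then show ?thesis
      using Suc by (simp add: fps_compose_linear nth distrib_right mult.assoc del: power_Suc)
  qed
qed

text \<open>
  The recurrence \<open>[n + 1]\<^sub>q a\<^sub>n\<^sub>+\<^sub>1 = (1 - q\<^sup>n x) a\<^sub>n\<close> for the coefficients of the product is what
  the dilation equations of its two factors amount to; it matches that of
  \<open>(1 - x)\<^sub>q\<^sup>n / [n]\<^sub>q!\<close>.
\<close>
lemma qexp_product_nth:
  assumes "norm q < 1"
  shows "(qexp_small q * (qexp_big q oo (fps_const (- x) * fps_X))) $ n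
         = qone_minus_pow q x n / qfact q n"
proof -
  define F where "F = qexp_small q * (qexp_big q oo (fps_const (- x) * fps_X))"
  have "(qexp_big q oo (fps_const (- x) * fps_X)) oo (fps_const q * fps_X)
          = qexp_big q oo (fps_const (- x * q) * fps_X)"
    by (simp only: fps_eq_iff fps_compose_linear fps_nth_Abs_fps power_mult_distrib) simp
  then have "F oo (fps_const q * fps_X)
      = (1 - fps_const (1 - q) * fps_X) * qexp_small q
          * (qexp_big q oo (fps_const (- x * q) * fps_X))"
    by (simp add: F_def fps_compose_mult_distrib qexp_small_dilate[OF assms])
  then have "(1 + fps_const ((1 - q) * - x) * fps_X) * (F oo (fps_const q * fps_X))
      = (1 - fps_const (1 - q) * fps_X) * F"
    unfolding F_def qexp_big_dilate[OF assms, of "- x"] by (simp only: mult_ac)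
  then have dilate: "((1 + fps_const ((1 - q) * - x) * fps_X) * (F oo (fps_const q * fps_X))) $ n
      = ((1 - fps_const (1 - q) * fps_X) * F) $ n" for n
    by simp
  have rec: "(1 - q ^ Suc n) * F $ Suc n = (1 - q) * (1 - q ^ n * x) * F $ n" for n
    using dilate[of "Suc n"] unfolding fps_compose_linear
    by (simp add: distrib_right left_diff_distrib mult.assoc) (simp add: algebra_simps)
  have "F $ n = qone_minus_pow q x n / qfact q n" for n
  proof (induction n)
    case 0
    show ?case
      by (simp add: F_def qexp_small_def qexp_big_def qone_minus_pow_def)
  next
    case (Suc n)
    have nonzero: "1 - q ^ Suc n \<noteq> 0"
      using qfact_nonzero[OF assms, of "Suc n"] by (auto simp: qfact_Suc qnat_def)
    have "(1 - q ^ Suc n) * F $ Suc n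
        = (1 - q ^ n * x) * qone_minus_pow q x n * ((1 - q) / qfact q n)"
      by (simp only: rec Suc.IH) simp
    also have "\<dots> = (1 - q ^ Suc n) * (qone_minus_pow q x (Suc n) / qfact q (Suc n))"
      by (simp only: inverse_qfact_Suc[OF assms, symmetric])
         (simp add: qone_minus_pow_def del: power_Suc)
    finally show ?case
      by (simp only: mult_left_cancel[OF nonzero])
  qed
  then show ?thesis
    by (simp add: F_def)
qed

lemma sum_qbinom_mult:
  "(\<Sum>m=0..n. qbinom q n m * a m * b (n - m))
    = qfact q n * (Abs_fps (\<lambda>m. a m / qfact q m) * Abs_fps (\<lambda>m. b m / qfact q m)) $ n"
  by (simp add: fps_mult_nth sum_distrib_left qbinom_def mult.assoc)

text \<open>
  The series \<open>e\<^sub>q(t) - 1\<close> has order exactly \<open>1\<close>, so it divides \<open>t\<close>, and its \<open>k\<close>-th power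
  cancels against the denominator of \<open>(t / (e\<^sub>q(t) - 1))\<^sup>k\<close>. The remaining \<open>t\<^sup>k\<close> shifts
  coefficients, which turns the index \<open>n\<close> into the \<open>n - k\<close> of the Bernstein polynomial.
\<close>
lemma qstirling2_mult_qbernoulli_genfun:
  assumes "norm q < 1"
  shows "Abs_fps (\<lambda>m. qstirling2 q m k / qfact q m)
           * Abs_fps (\<lambda>m. qbernoulli_poly q (of_nat k) m x y / qfact q m)
         = fps_const (1 / qfact q k) * fps_X ^ k
             * ((qexp_small q oo (fps_const x * fps_X)) * (qexp_big q oo (fps_const y * fps_X)))"
proof -
  let ?g = "qexp_small q - 1"
  have "?g $ 1 \<noteq> 0"
    using qfact_nonzero[OF assms, of 1] by (simp add: qexp_small_def)
  then have "?g \<noteq> 0" "subdegree ?g \<le> 1"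
    by (auto intro: subdegree_leI)
  then have "?g dvd fps_X"
    by (simp add: fps_dvd_iff)
  then have "?g ^ k * (fps_X / ?g) ^ k = fps_X ^ k"
    by (simp add: power_mult_distrib[symmetric])
  then have cancel: "C * ?g ^ k * ((fps_X / ?g) ^ k * A * B) = C * fps_X ^ k * (A * B)" for A B C
    by (metis (no_types, lifting) mult.assoc)
  show ?thesis
    by (simp only: qstirling2_genfun[OF assms, symmetric] qbernoulli_poly_genfun[OF assms, symmetric]
        fps_cpow_of_nat[OF qbernoulli_base_nth_0[OF assms]] cancel)
qed

theorem theorem19:
  fixes q x :: complex and n k :: nat
  assumes "0 < norm q" and "norm q < 1" and "k \<le> n"
  shows "qbernstein q n k x =
    x ^ k * (\<Sum>m=0..n. qbinom q n m * qstirling2 q m k * qbernoulli_poly q (of_nat k) (n - m) 1 (- x))"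
proof -
  have "(\<Sum>m=0..n. qbinom q n m * qstirling2 q m k * qbernoulli_poly q (of_nat k) (n - m) 1 (- x))
      = qfact q n * (fps_const (1 / qfact q k)
          * (fps_X ^ k * (qexp_small q * (qexp_big q oo (fps_const (- x) * fps_X))))) $ n"
    by (subst sum_qbinom_mult[where a = "\<lambda>m. qstirling2 q m k"
          and b = "\<lambda>m. qbernoulli_poly q (of_nat k) m 1 (- x)"])
      (simp only: qstirling2_mult_qbernoulli_genfun[OF assms(2)]
        fps_const_1_eq_1 mult_1_left fps_compose_fps_X mult.assoc)
  also have "\<dots> = qfact q n / qfact q k * (qone_minus_pow q x (n - k) / qfact q (n - k))"
    using assms(3) by (simp only: fps_mult_left_const_nth fps_X_power_mult_nth
        qexp_product_nth[OF assms(2)]) simp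
  finally show ?thesis
    by (simp add: qbernstein_def qbinom_def)
qed

end
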